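(* Let $S\subset\mathbb{R}^d$ be a non-empty compact set with $\mu_d(\mathrm{co}(S))>0$, and let $X_1,X_2,\dots$ be iid random vectors in $\mathbb{R}^d$ whose common distribution has support $S$. Put $\aleph_n=\{X_1,\dots,X_n\}$. Let $(S_n)_{n\ge 1}$ be any sequence of (random, Borel) sets such that $d_{\mu_d}(S,S_n)\to 0$ almost surely. Then $$\hat{\mathcal{M}}(S_n)\to\mathcal{M}(S)\quad\text{almost surely}.$$
   Context: $\mu_d$ is Lebesgue measure on $\mathbb{R}^d$ and $\mathrm{co}(A)$ is the convex hull of $A$. The distance in measure between $A$ and $C$ is $d_{\mu_d}(A,C)=\mu_d(A\setminus C)+\mu_d(C\setminus A)$. The measure of non-convexity $\mathcal{M}$ and its estimator are $$\mathcal{M}(S)=\frac{\mu_d(\mathrm{co}(S)\setminus S)}{\mu_d(\mathrm{co}(S))},\qquad \hat{\mathcal{M}}(S_n)=\frac{\mu_d(\mathrm{co}(\aleph_n)\setminus S_n)}{\mu_d(\mathrm{co}(\aleph_n))}.$$ The quantity $\hat{\mathcal{M}}(S_n)$ is considered whenever $\mu_d(\mathrm{co}(\aleph_n))>0$. *)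

theory Defs
  imports "HOL-Probability.Probability"
begin

text \<open>The topological support of a Borel measure. For a probability measure on a Euclidean
  space it is the smallest closed set of measure one.\<close>

definition measure_support :: "'a::topological_space measure \<Rightarrow> 'a set" where
  "measure_support P = {x. \<forall>U. open U \<and> x \<in> U \<longrightarrow> emeasure P U > 0}"

text \<open>The distance in measure takes values in the extended non-negative reals, so that sets whose
  symmetric difference has infinite measure are at infinite distance.\<close>

definition dist_in_measure :: "'a::euclidean_space set \<Rightarrow> 'a set \<Rightarrow> ennreal" where
  "dist_in_measure A C = emeasure lebesgue (A - C) + emeasure lebesgue (C - A)"

definition nonconvexity :: "'a::euclidean_space set \<Rightarrow> real" where
  "nonconvexity S =
     measure lebesgue (convex hull S - S) / measure lebesgue (convex hull S)"

definition sample :: "(nat \<Rightarrow> 'w \<Rightarrow> 'a) \<Rightarrow> nat \<Rightarrow> 'w \<Rightarrow> 'a set" where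
  "sample X n \<omega> = (\<lambda>i. X i \<omega>) ` {1..n}"

text \<open>The estimator depends on the sample \<open>N\<close> and on the set estimate \<open>T\<close>. It is meaningful only
  if the convex hull of \<open>N\<close> has positive measure (otherwise division by zero makes it 0).\<close>

definition nonconvexity_estimator :: "'a::euclidean_space set \<Rightarrow> 'a set \<Rightarrow> real" where
  "nonconvexity_estimator N T =
     measure lebesgue (convex hull N - T) / measure lebesgue (convex hull N)"

end

theory Submission
  imports Defs
begin

text \<open>Randomness enters only once: almost surely the sample points all lie in \<open>S\<close>
  and are dense in \<open>S\<close> (\<open>AE_iid_dense_in_support\<close>). The rest is
  deterministic, for one fixed outcome. The hulls of the first n sample points increase to a convex
  set C inside co(S). Density puts S, hence co(S), into the closure of C. So co(S) - C lies in the
  frontier of a convex set and is null, and continuity from below makes the volumes of the sample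
  hulls converge to that of co(S) (\<open>measure_convex_hull_initial_segments\<close>). For the
  numerators, replacing the sample hull by co(S) costs at most the missing volume of the hull, and
  replacing the set estimate by \<open>S\<close> costs at most their distance in measure; both
  errors vanish (\<open>tendsto_measure_Diff\<close>). The limit of the denominators is positive, so
  the quotients converge.\<close>

text \<open>Every point outside the support has a null basic neighbourhood. Second countability
  turns the possibly uncountable union of null open sets into a countable one.\<close>

lemma null_sets_compl_measure_support:
  fixes P :: "'a::second_countable_topology measure"
  assumes sets: "sets P = sets borel"
  shows "- measure_support P \<in> null_sets P"
proof -
  obtain B :: "'a set set" where B: "countable B" "topological_basis B"
    using ex_countable_basis by blast
  have eq: "- measure_support P = (\<Union>b\<in>{b\<in>B. emeasure P b = 0}. b)"
  proof (intro set_eqI iffI)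
    fix x assume "x \<in> - measure_support P"
    then obtain U where U: "open U" "x \<in> U" "emeasure P U = 0"
      by (auto simp: measure_support_def)
    obtain b where b: "b \<in> B" "x \<in> b" "b \<subseteq> U"
      using B(2) U by (meson topological_basisE)
    have "emeasure P b \<le> emeasure P U"
      using U b by (intro emeasure_mono) (auto simp: sets)
    then show "x \<in> (\<Union>b\<in>{b\<in>B. emeasure P b = 0}. b)"
      using U b by auto
  next
    fix x assume "x \<in> (\<Union>b\<in>{b\<in>B. emeasure P b = 0}. b)"
    then show "x \<in> - measure_support P"
      using topological_basis_open[OF B(2)] by (force simp: measure_support_def)
  qed
  show ?thesis
    unfolding eq using B topological_basis_open[OF B(2)]
    by (intro null_sets_UN') (auto simp: null_sets_def sets)
qed

text \<open>If one draw hits \<open>U\<close> with probability p > 0, then n independent draws all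
  miss it with probability (1 - p)^n, which tends to 0.\<close>

lemma (in prob_space) AE_iid_hits:
  assumes indep: "indep_vars (\<lambda>_. N) X {1::nat..}"
    and distr: "\<And>i. i \<ge> 1 \<Longrightarrow> distr M N (X i) = distr M N (X 1)"
    and U: "U \<in> sets N" "emeasure (distr M N (X 1)) U > 0"
  shows "AE \<omega> in M. \<exists>i\<ge>1. X i \<omega> \<in> U"
proof -
  have meas: "X i \<in> measurable M N" if "i \<ge> 1" for i
    using indep that by (auto simp: indep_vars_def)
  define p where "p = measure (distr M N (X 1)) U"
  interpret D: prob_space "distr M N (X 1)"
    using meas by (intro prob_space_distr) auto
  have p: "0 < p" "p \<le> 1"
    using U(2) D.prob_le_1[of U] D.emeasure_eq_measure[of U] by (simp_all add: p_def del: One_nat_def)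
  define Q where "Q = {\<omega>\<in>space M. \<forall>i\<ge>1. X i \<omega> \<notin> U}"
  have Q_sets: "Q \<in> sets M"
    unfolding Q_def using meas U(1) by measurable
  have miss: "prob (X i -` (space N - U) \<inter> space M) = 1 - p" if "i \<ge> 1" for i
  proof -
    have "prob (X i -` (space N - U) \<inter> space M) = measure (distr M N (X i)) (space N - U)"
      using meas[OF that] U by (subst measure_distr) auto
    also have "\<dots> = 1 - p"
      using D.prob_compl[of U] U(1) by (simp add: distr[OF that] p_def)
    finally show ?thesis .
  qed
  have le: "prob Q \<le> (1 - p) ^ n" for n
  \<comment> \<open>The product rule for independent variables needs a nonempty index set; for n = 0
    the bound only says that a probability is at most 1.\<close>
  proof (cases "n = 0")
    case False
    have "prob Q \<le> prob (\<Inter>i\<in>{1..n}. X i -` (space N - U) \<inter> space M)"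
    proof (rule finite_measure_mono)
      show "Q \<subseteq> (\<Inter>i\<in>{1..n}. X i -` (space N - U) \<inter> space M)"
        using measurable_space[OF meas] by (auto simp: Q_def)
      show "(\<Inter>i\<in>{1..n}. X i -` (space N - U) \<inter> space M) \<in> sets M"
        using False meas U(1) by (intro sets.finite_INT measurable_sets) auto
    qed
    also have "\<dots> = (\<Prod>i\<in>{1..n}. prob (X i -` (space N - U) \<inter> space M))"
      using False U(1) by (intro indep_varsD[OF indep]) auto
    also have "\<dots> = (1 - p) ^ n"
      using miss by simp
    finally show ?thesis .
  qed simp
  have "(\<lambda>n. (1 - p) ^ n) \<longlonglongrightarrow> 0"
    using p by (intro LIMSEQ_realpow_zero) auto
  then have "prob Q \<le> 0"
    using le by (intro LIMSEQ_le_const) auto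
  then have "emeasure M Q = 0"
    by (simp add: emeasure_eq_measure measure_le_0_iff)
  then show ?thesis
    by (subst AE_iff_measurable[OF Q_sets]) (auto simp: Q_def)
qed

text \<open>Almost sure statements combine only countably often, so density is tested on a countable
  base: a basic set containing a point of the support has positive mass and is therefore hit almost
  surely.\<close>

lemma AE_iid_dense_in_support:
  fixes X :: "nat \<Rightarrow> 'w \<Rightarrow> 'a::second_countable_topology"
  assumes "prob_space M"
    and indep: "prob_space.indep_vars M (\<lambda>_. borel) X {1..}"
    and distr: "\<And>i. i \<ge> 1 \<Longrightarrow> distr M borel (X i) = distr M borel (X 1)"
  defines "S \<equiv> measure_support (distr M borel (X 1))"
  shows "AE \<omega> in M. (\<lambda>i. X i \<omega>) ` {1..} \<subseteq> S \<and> S \<subseteq> closure ((\<lambda>i. X i \<omega>) ` {1..})"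
proof -
  interpret prob_space M by fact
  have meas: "X i \<in> borel_measurable M" if "i \<ge> 1" for i
    using indep that by (auto simp: indep_vars_def)
  have "AE \<omega> in M. X i \<omega> \<in> S" if "i \<ge> 1" for i
  proof -
    have "AE x in distr M borel (X i). x \<in> S"
      using null_sets_compl_measure_support[of "distr M borel (X 1)"]
      unfolding distr[OF that] S_def by (intro AE_I'[of "- S"]) (auto simp: S_def)
    then show ?thesis
      by (rule AE_distrD[OF meas[OF that]])
  qed
  then have "AE \<omega> in M. \<forall>i\<in>{1..}. X i \<omega> \<in> S"
    by (subst AE_ball_countable) auto
  moreover obtain B :: "'a set set" where B: "countable B" "topological_basis B"
    using ex_countable_basis by blast
  have "AE \<omega> in M. \<forall>b\<in>{b\<in>B. emeasure (distr M borel (X 1)) b > 0}. \<exists>i\<ge>1. X i \<omega> \<in> b"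
  proof (subst AE_ball_countable)
    show "\<forall>b\<in>{b\<in>B. emeasure (distr M borel (X 1)) b > 0}. AE \<omega> in M. \<exists>i\<ge>1. X i \<omega> \<in> b"
      using topological_basis_open[OF B(2)] by (intro ballI AE_iid_hits[OF indep distr]) auto
  qed (use B in auto)
  ultimately show ?thesis
  proof eventually_elim
    case (elim \<omega>)
    have "x \<in> closure ((\<lambda>i. X i \<omega>) ` {1..})" if "x \<in> S" for x
      unfolding closure_iff_nhds_not_empty
    proof (intro allI impI)
      fix A V assume "V \<subseteq> A" "open V" "x \<in> V"
      then obtain b where "b \<in> B" "x \<in> b" "b \<subseteq> V"
        using B(2) by (meson topological_basisE)
      moreover have "emeasure (distr M borel (X 1)) b > 0"
        using calculation topological_basis_open[OF B(2)] \<open>x \<in> S\<close>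
        by (auto simp: S_def measure_support_def)
      ultimately show "(\<lambda>i. X i \<omega>) ` {1..} \<inter> A \<noteq> {}"
        using elim \<open>V \<subseteq> A\<close> by blast
    qed
    then show ?case using elim by auto
  qed
qed

text \<open>The hulls of the initial segments increase to a convex set whose closure is the hull
  of \<open>S\<close>, so the two differ by part of the frontier of a convex set, which is Lebesgue null.\<close>

lemma measure_convex_hull_initial_segments:
  fixes x :: "nat \<Rightarrow> 'a::euclidean_space"
  assumes S: "compact S" and sub: "x ` {1..} \<subseteq> S" and dense: "S \<subseteq> closure (x ` {1..})"
  shows "(\<lambda>n. measure lebesgue (convex hull (x ` {1..n}))) \<longlonglongrightarrow> measure lebesgue (convex hull S)"
proof -
  define K where "K n = convex hull (x ` {1..n})" for n
  define C where "C = (\<Union>n. K n)"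
  have cpt: "compact (convex hull S)" "compact (K n)" for n
    using S by (auto simp: K_def compact_convex_hull finite_imp_compact)
  have lm: "convex hull S \<in> lmeasurable" "K n \<in> lmeasurable" for n
    using cpt by (auto intro: lmeasurable_compact)
  have inc: "incseq K"
    unfolding K_def by (intro monoI hull_mono image_mono) auto
  have K_sub: "K n \<subseteq> convex hull S" for n
    unfolding K_def using sub by (intro hull_mono) auto
  have "convex C"
  proof (rule convexI)
    fix y z and u v :: real
    assume "y \<in> C" "z \<in> C" and uv: "0 \<le> u" "0 \<le> v" "u + v = 1"
    then obtain m n where "y \<in> K m" "z \<in> K n"
      by (auto simp: C_def)
    then have "y \<in> K (max m n)" "z \<in> K (max m n)"
      using monoD[OF inc] by (meson max.cobounded1 max.cobounded2 subsetD)+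
    then have "u *\<^sub>R y + v *\<^sub>R z \<in> K (max m n)"
      using uv unfolding K_def by (intro convexD) auto
    then show "u *\<^sub>R y + v *\<^sub>R z \<in> C"
      by (auto simp: C_def)
  qed
  have "x i \<in> K i" if "i \<ge> 1" for i
    using that unfolding K_def by (intro hull_inc) auto
  then have "S \<subseteq> closure C"
    using dense closure_mono[of "x ` {1..}" C] by (auto simp: C_def)
  \<comment> \<open>The closure of a convex set is convex, so containing \<open>S\<close> suffices
    for containing its hull.\<close>
  then have "convex hull S \<subseteq> closure C"
    using \<open>convex C\<close> by (intro hull_minimal) auto
  then have diff: "convex hull S - C \<subseteq> frontier C"
    using interior_subset by (auto simp: frontier_def)
  have C_sub: "C \<subseteq> convex hull S"
    using K_sub by (auto simp: C_def)
  have C_lm: "C \<in> lmeasurable"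
    using lm C_sub unfolding C_def by (intro fmeasurableI2[OF lm(1)]) auto
  have "(\<lambda>n. measure lebesgue (K n)) \<longlonglongrightarrow> measure lebesgue C"
    unfolding C_def
    using lm inc fmeasurableD2[OF C_lm] by (intro Lim_measure_incseq) (auto simp: C_def)
  also have "measure lebesgue C = measure lebesgue (convex hull S)"
  proof (rule measure_negligible_symdiff[OF lm(1)])
    show "negligible (convex hull S - C \<union> (C - convex hull S))"
      using diff C_sub negligible_convex_frontier[OF \<open>convex C\<close>]
      by (auto intro: negligible_subset)
  qed
  finally show ?thesis
    by (simp add: K_def)
qed

text \<open>Two inclusions compare the sets: \<open>K n - T n\<close> lies in
  \<open>(H - S) \<union> (S - T n)\<close>, and \<open>H - S\<close> lies in
  \<open>(K n - T n) \<union> (H - K n) \<union> (T n - S)\<close>. The surplus pieces have volume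
  at most that of \<open>H - K n\<close> plus the distance in measure.\<close>

lemma tendsto_measure_Diff:
  fixes K :: "nat \<Rightarrow> 'a::euclidean_space set"
  assumes H: "H \<in> lmeasurable" and S: "S \<in> sets lebesgue"
    and K: "\<And>n. K n \<in> sets lebesgue" "\<And>n. K n \<subseteq> H"
    and lim: "(\<lambda>n. measure lebesgue (K n)) \<longlonglongrightarrow> measure lebesgue H"
    and T: "\<And>n. n \<ge> 1 \<Longrightarrow> T n \<in> sets lebesgue"
    and dist: "(\<lambda>n. dist_in_measure S (T n)) \<longlonglongrightarrow> 0"
  shows "(\<lambda>n. measure lebesgue (K n - T n)) \<longlonglongrightarrow> measure lebesgue (H - S)"
proof -
  define d where "d n = enn2real (dist_in_measure S (T n))" for n
  have d_lim: "d \<longlonglongrightarrow> 0"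
    using tendsto_enn2real[of _ 0] dist unfolding d_def by simp
  \<comment> \<open>Finitely many distances may be infinite, and \<open>enn2real\<close> sends
    infinity to 0, so \<open>d n\<close> is a valid error term only from some index on.\<close>
  have fin: "\<forall>\<^sub>F n in sequentially. dist_in_measure S (T n) < top"
    using order_tendstoD(2)[OF dist, of top] by simp
  have Klm: "K n \<in> lmeasurable" for n
    using H K by (meson fmeasurableI2)
  have bound: "\<forall>\<^sub>F n in sequentially.
     norm (measure lebesgue (K n - T n) - measure lebesgue (H - S))
       \<le> (measure lebesgue H - measure lebesgue (K n)) + d n"
    using fin eventually_ge_at_top[of 1]
  proof eventually_elim
    case (elim n)
    note Tn = T[OF elim(2)]
    have lm: "S - T n \<in> lmeasurable" "T n - S \<in> lmeasurable"
      using elim S Tn by (auto simp: dist_in_measure_def fmeasurable_def)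
    have d: "d n = measure lebesgue (S - T n) + measure lebesgue (T n - S)"
      unfolding d_def dist_in_measure_def measure_def using lm
      by (intro enn2real_plus) (auto simp: fmeasurable_def)
    have lm': "H - S \<in> lmeasurable" "K n - T n \<in> lmeasurable" "H - K n \<in> lmeasurable"
      using H Klm S Tn by (auto intro: fmeasurable_Diff)
    have "measure lebesgue (K n - T n) \<le> measure lebesgue ((H - S) \<union> (S - T n))"
      using K lm lm' by (intro measure_mono_fmeasurable) auto
    also have "\<dots> \<le> measure lebesgue (H - S) + measure lebesgue (S - T n)"
      using lm lm' by (intro measure_Un_le) auto
    finally have 1: "measure lebesgue (K n - T n) \<le> \<dots>" .
    have "measure lebesgue (H - S) \<le> measure lebesgue ((K n - T n) \<union> (H - K n) \<union> (T n - S))"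
      using K lm lm' by (intro measure_mono_fmeasurable) auto
    also have "\<dots> \<le> measure lebesgue ((K n - T n) \<union> (H - K n)) + measure lebesgue (T n - S)"
      using lm lm' by (intro measure_Un_le) auto
    also have "measure lebesgue ((K n - T n) \<union> (H - K n))
        \<le> measure lebesgue (K n - T n) + measure lebesgue (H - K n)"
      using lm lm' by (intro measure_Un_le) auto
    also have "measure lebesgue (H - K n) = measure lebesgue H - measure lebesgue (K n)"
      using H Klm K by (intro measurable_measure_Diff) auto
    finally have 2: "measure lebesgue (H - S) \<le> measure lebesgue (K n - T n)
        + (measure lebesgue H - measure lebesgue (K n)) + measure lebesgue (T n - S)"
      by simp
    have "measure lebesgue (K n) \<le> measure lebesgue H"
      using H K by (intro measure_mono_fmeasurable) auto
    then show ?case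
      using 1 2 d measure_nonneg[of lebesgue "S - T n"] measure_nonneg[of lebesgue "T n - S"]
      unfolding real_norm_def by linarith
  qed
  have "(\<lambda>n. (measure lebesgue H - measure lebesgue (K n)) + d n) \<longlonglongrightarrow> 0"
    using tendsto_add[OF tendsto_diff[OF tendsto_const[of "measure lebesgue H"] lim] d_lim] by simp
  from Lim_null_comparison[OF bound this] show ?thesis
    by (simp add: LIM_zero_iff)
qed

theorem theorem4p2:
  fixes M :: "'w measure"
    and X :: "nat \<Rightarrow> 'w \<Rightarrow> real ^ 'd"
    and S :: "(real ^ 'd) set"
    and Sn :: "nat \<Rightarrow> 'w \<Rightarrow> (real ^ 'd) set"
  assumes "prob_space M"
    and "compact S" and "S \<noteq> {}"
    and "emeasure lebesgue (convex hull S) > 0"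
    and "prob_space.indep_vars M (\<lambda>_. borel) X {1..}"
    and "\<And>i. i \<ge> 1 \<Longrightarrow> distr M borel (X i) = distr M borel (X 1)"
    and "measure_support (distr M borel (X 1)) = S"
    and "\<And>n \<omega>. n \<ge> 1 \<Longrightarrow> \<omega> \<in> space M \<Longrightarrow> Sn n \<omega> \<in> sets borel"
    and "AE \<omega> in M. (\<lambda>n. dist_in_measure S (Sn n \<omega>)) \<longlonglongrightarrow> 0"
  shows "AE \<omega> in M.
           (\<forall>\<^sub>F n in sequentially. emeasure lebesgue (convex hull (sample X n \<omega>)) > 0) \<and>
           (\<lambda>n. nonconvexity_estimator (sample X n \<omega>) (Sn n \<omega>)) \<longlonglongrightarrow> nonconvexity S"
proof -
  have "AE \<omega> in M. (\<lambda>i. X i \<omega>) ` {1..} \<subseteq> S \<and> S \<subseteq> closure ((\<lambda>i. X i \<omega>) ` {1..})"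
    using AE_iid_dense_in_support[OF assms(1,5,6)] assms(7) by simp
  with assms(9) AE_space show ?thesis
  proof eventually_elim
    case (elim \<omega>)
    have hull: "convex hull S \<in> lmeasurable"
      using assms(2) by (intro lmeasurable_compact compact_convex_hull)
    have sample_hull: "convex hull (sample X n \<omega>) \<in> lmeasurable" for n
      unfolding sample_def
      by (intro lmeasurable_compact compact_convex_hull finite_imp_compact finite_imageI) simp
    have pos: "measure lebesgue (convex hull S) > 0"
      using assms(4) hull by (simp add: emeasure_eq_measure2)
    have lim: "(\<lambda>n. measure lebesgue (convex hull (sample X n \<omega>)))
        \<longlonglongrightarrow> measure lebesgue (convex hull S)"
      unfolding sample_def using elim assms(2) by (intro measure_convex_hull_initial_segments) auto
    \<comment> \<open>The limit is positive, so the default value 0 of a division by zero can affect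
      only finitely many terms of the estimator.\<close>
    have "\<forall>\<^sub>F n in sequentially. measure lebesgue (convex hull (sample X n \<omega>)) > 0"
      using order_tendstoD(1)[OF lim pos] .
    then have "\<forall>\<^sub>F n in sequentially. emeasure lebesgue (convex hull (sample X n \<omega>)) > 0"
      by eventually_elim (auto simp: measure_def enn2real_positive_iff)
    moreover have "(\<lambda>n. measure lebesgue (convex hull (sample X n \<omega>) - Sn n \<omega>))
        \<longlonglongrightarrow> measure lebesgue (convex hull S - S)"
    proof (rule tendsto_measure_Diff[OF hull _ _ _ lim])
      show "S \<in> sets lebesgue"
        using assms(2) by (simp add: borel_compact)
      show "convex hull (sample X n \<omega>) \<subseteq> convex hull S" for n
        using elim by (intro hull_mono) (auto simp: sample_def)
    qed (use elim assms(8) sample_hull in auto)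
    ultimately show ?case
      unfolding nonconvexity_estimator_def nonconvexity_def
      using lim pos by (auto intro!: tendsto_divide)
  qed
qed

end
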